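(* Let $c_2\in[\frac3{11},1]$. Consider the two-stage EERK2-w method $$U^{n,1}=u_h^{n-1},\qquad U^{n,i+1}=U^{n,1}+\sum_{j=1}^{i}a_{i+1,j}(-\tau L_\kappa)\left[\tau g_\kappa(U^{n,j})-\tau L_\kappa U^{n,1}\right]\ (i=1,2),\qquad u_h^n=U^{n,3},$$ with $a_{21}(z)=c_2\varphi_1(c_2z)$, $a_{31}(z)=\big(1-\frac1{2c_2}\big)\varphi_1(z)$, $a_{32}(z)=\frac1{2c_2}\varphi_1(z)$, where $g_h$ is Lipschitz continuous with constant $\ell_g>0$ and $\kappa\ge2\ell_g$. Then the method preserves the energy dissipation law at all stages: for every $\tau>0$, $n\ge1$ and $j\in\{1,2\}$, $$E[U^{n,j+1}]-E[U^{n,1}]\le-\frac1\tau\sum_{k=1}^{j}\Big\langle\delta_\tau U^{n,k+1},\sum_{\ell=1}^{k}d^{(2,w)}_{k\ell}(c_2,-\tau L_\kappa)\,\delta_\tau U^{n,\ell+1}\Big\rangle\le0,$$ where $\delta_\tau U^{n,k+1}:=U^{n,k+1}-U^{n,k}$ and $$D^{(2,w)}(c_2,z)=(d^{(2,w)}_{k\ell}(c_2,z))=\begin{pmatrix}\frac1{c_2\varphi_1(c_2z)}+\frac z2&0\\[4pt]\frac{2c_2}{\varphi_1(z)}+\frac{1-2c_2}{c_2\varphi_1(c_2z)}+z&\frac{2c_2}{\varphi_1(z)}+\frac z2\end{pmatrix}.$$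
   Context: $\langle u,v\rangle=v^Tu$ and $\|v\|=\sqrt{\langle v,v\rangle}$ on $\mathbb{R}^M$; Lipschitz is with respect to $\|\cdot\|$. $L_h\in\mathbb{R}^{M\times M}$ is symmetric positive definite. $G_h\ge0$ is a non-negative Lyapunov function with $g_h(v)=-\frac{\delta}{\delta v}G_h(v)$, i.e. the gradient of the scalar function $v\mapsto\langle G_h(v),1\rangle$ is $-g_h(v)$, where $1$ is the all-ones vector. The energy is $E[v]=\frac12\langle v,L_hv\rangle+\langle G_h(v),1\rangle$. Stabilized operators: $L_\kappa:=L_h+\kappa I$, $g_\kappa(u):=g_h(u)+\kappa u$. $\varphi_1(z)=(e^z-1)/z$ (with $\varphi_1(0)=1$). For a function $f$, $f(-\tau L_\kappa)$ is the matrix function defined through the spectrum of the symmetric matrix $-\tau L_\kappa$. *)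

theory Defs
  imports "HOL-Analysis.Analysis"
begin

definition sym_pos_def :: "real^'m^'m \<Rightarrow> bool" where
  "sym_pos_def A \<longleftrightarrow> transpose A = A \<and> (\<forall>v. v \<noteq> 0 \<longrightarrow> v \<bullet> (A *v v) > 0)"

definition diag_matrix :: "real^'m \<Rightarrow> real^'m^'m" where
  "diag_matrix d = (\<chi> i j. if i = j then d $ i else 0)"

(* f(A) for symmetric A: if A = Q diag(d) Q^T with Q orthogonal, then f(A) = Q diag(f(d)) Q^T.
   The value does not depend on the diagonalization, see matrix_fun_diagonalization;
   for A that is not symmetric the value is unspecified. *)
definition matrix_fun :: "(real \<Rightarrow> real) \<Rightarrow> real^'m^'m \<Rightarrow> real^'m^'m" where
  "matrix_fun f A = (THE B. \<exists>Q d. orthogonal_matrix Q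
     \<and> A = Q ** diag_matrix d ** transpose Q
     \<and> B = Q ** diag_matrix (\<chi> i. f (d $ i)) ** transpose Q)"

lemma diag_matrix_mult_left: "(diag_matrix d ** A) $ i $ j = d $ i * A $ i $ j"
  by (simp add: diag_matrix_def matrix_matrix_mult_def if_distrib[of "\<lambda>x. x * _"] cong: if_cong)

lemma diag_matrix_mult_right: "(A ** diag_matrix d) $ i $ j = A $ i $ j * d $ j"
  by (simp add: diag_matrix_def matrix_matrix_mult_def if_distrib[of "\<lambda>x. _ * x"] cong: if_cong)

lemma diagonalization_fun_unique:
  fixes Q R :: "real^'m^'m"
  assumes Q: "orthogonal_matrix Q" and R: "orthogonal_matrix R"
    and eq: "Q ** diag_matrix d ** transpose Q = R ** diag_matrix e ** transpose R"
  shows "Q ** diag_matrix (\<chi> i. f (d $ i)) ** transpose Q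
       = R ** diag_matrix (\<chi> i. f (e $ i)) ** transpose R"
proof -
  define S where "S = transpose R ** Q"
  have QQ: "transpose Q ** Q = mat 1" "Q ** transpose Q = mat 1"
    and RR: "transpose R ** R = mat 1" "R ** transpose R = mat 1"
    using Q R by (auto simp: orthogonal_matrix_def)
  have "S ** diag_matrix d = transpose R ** (Q ** diag_matrix d ** transpose Q) ** Q"
    by (simp add: S_def matrix_mul_assoc[symmetric] QQ)
  also have "\<dots> = diag_matrix e ** S"
    unfolding eq by (simp add: S_def matrix_mul_assoc RR)
  finally have *: "S $ i $ j = 0 \<or> d $ j = e $ i" for i j
    using diag_matrix_mult_left[of e S i j] diag_matrix_mult_right[of S d i j] by auto
  have "S $ i $ j * f (d $ j) = f (e $ i) * S $ i $ j" for i j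
    using *[of i j] by auto
  then have SD: "S ** diag_matrix (\<chi> i. f (d $ i)) = diag_matrix (\<chi> i. f (e $ i)) ** S"
    by (simp add: vec_eq_iff diag_matrix_mult_left diag_matrix_mult_right)
  have "Q ** diag_matrix (\<chi> i. f (d $ i)) ** transpose Q
      = R ** (S ** diag_matrix (\<chi> i. f (d $ i))) ** transpose Q"
    by (simp add: S_def matrix_mul_assoc RR)
  also have "\<dots> = R ** diag_matrix (\<chi> i. f (e $ i)) ** transpose R"
    unfolding SD by (simp add: S_def matrix_mul_assoc[symmetric] QQ)
  finally show ?thesis .
qed

lemma matrix_fun_diagonalization:
  assumes "orthogonal_matrix Q"
  shows "matrix_fun f (Q ** diag_matrix d ** transpose Q)
       = Q ** diag_matrix (\<chi> i. f (d $ i)) ** transpose Q"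
  unfolding matrix_fun_def
proof (rule the_equality)
  show "\<exists>Q' d'. orthogonal_matrix Q'
     \<and> Q ** diag_matrix d ** transpose Q = Q' ** diag_matrix d' ** transpose Q'
     \<and> Q ** diag_matrix (\<chi> i. f (d $ i)) ** transpose Q
       = Q' ** diag_matrix (\<chi> i. f (d' $ i)) ** transpose Q'"
    using assms by blast
next
  fix B
  assume "\<exists>Q' d'. orthogonal_matrix Q'
     \<and> Q ** diag_matrix d ** transpose Q = Q' ** diag_matrix d' ** transpose Q'
     \<and> B = Q' ** diag_matrix (\<chi> i. f (d' $ i)) ** transpose Q'"
  then obtain R e where "orthogonal_matrix R"
    and "Q ** diag_matrix d ** transpose Q = R ** diag_matrix e ** transpose R"
    and B: "B = R ** diag_matrix (\<chi> i. f (e $ i)) ** transpose R"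
    by blast
  from diagonalization_fun_unique[OF assms this(1,2)]
  show "B = Q ** diag_matrix (\<chi> i. f (d $ i)) ** transpose Q"
    by (simp only: B)
qed

definition phi1 :: "real \<Rightarrow> real" where
  "phi1 z = (if z = 0 then 1 else (exp z - 1) / z)"

definition L_stab :: "real \<Rightarrow> real^'m^'m \<Rightarrow> real^'m^'m" where
  "L_stab \<kappa> L = L + \<kappa> *\<^sub>R mat 1"

definition g_stab :: "real \<Rightarrow> (real^'m \<Rightarrow> real^'m) \<Rightarrow> real^'m \<Rightarrow> real^'m" where
  "g_stab \<kappa> g u = g u + \<kappa> *\<^sub>R u"

(* Here 1 :: real^'m is the all-ones vector. *)
definition energy :: "real^'m^'m \<Rightarrow> (real^'m \<Rightarrow> real^'m) \<Rightarrow> real^'m \<Rightarrow> real" where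
  "energy L G v = 1/2 * (v \<bullet> (L *v v)) + G v \<bullet> 1"

definition eerk2w_coeff :: "real \<Rightarrow> nat \<Rightarrow> nat \<Rightarrow> real \<Rightarrow> real" where
  "eerk2w_coeff c2 i j z =
    (if i = 2 \<and> j = 1 then c2 * phi1 (c2 * z)
     else if i = 3 \<and> j = 1 then (1 - 1 / (2 * c2)) * phi1 z
     else if i = 3 \<and> j = 2 then 1 / (2 * c2) * phi1 z
     else 0)"

(* u n is the solution at time level n, and U n i is the i-th stage of the step from u (n - 1)
   to u n; only the values U n 1, U n 2, U n 3 with n \<ge> 1 are constrained. *)
definition eerk2w_method :: "real \<Rightarrow> real \<Rightarrow> real \<Rightarrow> real^'m^'m \<Rightarrow> (real^'m \<Rightarrow> real^'m)
    \<Rightarrow> (nat \<Rightarrow> real^'m) \<Rightarrow> (nat \<Rightarrow> nat \<Rightarrow> real^'m) \<Rightarrow> bool" where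
  "eerk2w_method c2 \<tau> \<kappa> L g u U \<longleftrightarrow> (\<forall>n\<ge>1.
     U n 1 = u (n - 1) \<and>
     (\<forall>i\<in>{1,2}. U n (i + 1) = U n 1 +
        (\<Sum>j=1..i. matrix_fun (eerk2w_coeff c2 (i + 1) j) (- \<tau> *\<^sub>R L_stab \<kappa> L) *v
           (\<tau> *\<^sub>R g_stab \<kappa> g (U n j) - \<tau> *\<^sub>R (L_stab \<kappa> L *v U n 1)))) \<and>
     u n = U n 3)"

definition d2w :: "real \<Rightarrow> nat \<Rightarrow> nat \<Rightarrow> real \<Rightarrow> real" where
  "d2w c2 k l z =
    (if k = 1 \<and> l = 1 then 1 / (c2 * phi1 (c2 * z)) + z / 2
     else if k = 2 \<and> l = 1 then 2 * c2 / phi1 z + (1 - 2 * c2) / (c2 * phi1 (c2 * z)) + z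
     else if k = 2 \<and> l = 2 then 2 * c2 / phi1 z + z / 2
     else 0)"

definition delta_stage :: "(nat \<Rightarrow> real^'m) \<Rightarrow> nat \<Rightarrow> real^'m" where
  "delta_stage V k = V k - V (k - 1)"

end

theory Submission
  imports Defs
begin

text \<open>Since $\<kappa>$ dominates the Lipschitz constant of $g_h$, the descent lemma bounds the energy increment of
$U^{n,k} \<rightarrow> U^{n,k+1}$ by the inner product of $\<delta> = \<delta>_\<tau> U^{n,k+1}$ with
$L_\<kappa> U^{n,k} - g_\<kappa>(U^{n,k}) + (1/2) L_\<kappa> \<delta>$. Inverting the lower triangular scheme turns this
residual into exactly $-1/\<tau>$ times row $k$ of $D^{(2,w)}$ applied to the stage differences.
All matrices involved are functions of $L_\<kappa>$, so in an eigenbasis the second inequality becomes the nonnegativity of a quadratic form in two variables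
for each eigenvalue $z < 0$ of $-\<tau> L_\<kappa>$.\<close>

subsection \<open>Diagonalization of symmetric matrices\<close>

text \<open>First-order optimality: the quadratic attains its minimum 0 at t = 0, so its derivative
  there vanishes. It turns maximality of the Rayleigh quotient into an eigenvalue equation.\<close>

lemma quadratic_nonneg_imp_linear_zero:
  fixes b c :: real
  assumes "\<And>t. 0 \<le> 2 * t * b + t\<^sup>2 * c"
  shows "b = 0"
proof (rule ccontr)
  assume "b \<noteq> 0"
  \<comment> \<open>Any s > 0 with s c < 1 serves: at t = - s b the linear term - 2 s b^2 outweighs
    t^2 c < s b^2.\<close>
  define s where "s = 1 / (\<bar>c\<bar> + 1)"
  have s: "s > 0" "s * c < 1"
    unfolding s_def by (auto simp: divide_simps)
  have "0 \<le> 2 * (- (s * b)) * b + (- (s * b))\<^sup>2 * c"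
    by (rule assms)
  also have "\<dots> = b\<^sup>2 * s * (s * c - 2)"
    by (simp add: power2_eq_square algebra_simps)
  also have "\<dots> < 0"
    using s \<open>b \<noteq> 0\<close> by (intro mult_pos_neg) auto
  finally show False by simp
qed

lemma symmetric_matrix_inner:
  fixes A :: "real^'m^'m"
  assumes "transpose A = A"
  shows "x \<bullet> (A *v y) = (A *v x) \<bullet> y"
  by (metis assms dot_lmul_matrix transpose_matrix_vector)

text \<open>The maximum of the Rayleigh quotient over the unit sphere of the invariant subspace is an eigenvalue.\<close>

lemma symmetric_matrix_eigenvector_in_subspace:
  fixes A :: "real^'m^'m"
  assumes sym: "transpose A = A" and W: "subspace W" "W \<noteq> {0}"
    and inv: "\<And>x. x \<in> W \<Longrightarrow> A *v x \<in> W"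
  obtains x l where "x \<in> W" "norm x = 1" "A *v x = l *\<^sub>R x"
proof -
  let ?S = "sphere 0 1 \<inter> W"
  from W obtain w where w: "w \<in> W" "w \<noteq> 0"
    using subspace_0 by blast
  have "(1 / norm w) *\<^sub>R w \<in> ?S"
    using w W(1) by (auto simp: subspace_mul)
  then have "?S \<noteq> {}" by blast
  moreover have "compact ?S"
    by (intro compact_Int_closed closed_subspace W) auto
  moreover have "continuous_on ?S (\<lambda>x. x \<bullet> (A *v x))"
    by (intro continuous_intros linear_continuous_on_compose matrix_vector_mul_linear)
  ultimately have "\<exists>x\<in>?S. \<forall>y\<in>?S. y \<bullet> (A *v y) \<le> x \<bullet> (A *v x)"
    by (intro continuous_attains_sup)
  then obtain x where x: "x \<in> ?S" and max: "\<And>y. y \<in> ?S \<Longrightarrow> y \<bullet> (A *v y) \<le> x \<bullet> (A *v x)"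
    by blast
  define l where "l = x \<bullet> (A *v x)"
  have psd: "y \<bullet> (A *v y) \<le> l * (y \<bullet> y)" if "y \<in> W" for y
  proof (cases "y = 0")
    case False
    have "(1 / norm y) *\<^sub>R y \<in> ?S"
      using False that W(1) by (auto simp: subspace_mul)
    from max[OF this] have "y \<bullet> (A *v y) / (norm y)\<^sup>2 \<le> l"
      by (simp add: l_def matrix_vector_mult_scaleR power2_eq_square)
    then show ?thesis
      using False by (simp add: divide_simps power2_norm_eq_inner split: if_splits)
  qed simp
  define r where "r = l *\<^sub>R x - A *v x"
  have rW: "r \<in> W"
    using x W(1) inv by (auto simp: r_def subspace_diff subspace_mul)
  have xx: "x \<bullet> x = 1"
    using x by (simp add: norm_eq_1)
  \<comment> \<open>Perturbing the maximizer \<open>x\<close> in the direction of its own residual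
    \<open>r\<close> makes the first-order coefficient |r|^2, which must therefore vanish.\<close>
  have "0 \<le> 2 * t * (r \<bullet> r) + t\<^sup>2 * (l * (r \<bullet> r) - r \<bullet> (A *v r))" for t
  proof -
    have "x + t *\<^sub>R r \<in> W"
      using x rW W(1) by (auto simp: subspace_add subspace_mul)
    from psd[OF this] have "0 \<le> l * ((x + t *\<^sub>R r) \<bullet> (x + t *\<^sub>R r))
        - (x + t *\<^sub>R r) \<bullet> (A *v (x + t *\<^sub>R r))" by simp
    also have "\<dots> = 2 * t * (l * (x \<bullet> r) - (A *v x) \<bullet> r) + t\<^sup>2 * (l * (r \<bullet> r) - r \<bullet> (A *v r))"
    proof -
      have "x \<bullet> (A *v r) = (A *v x) \<bullet> r" "r \<bullet> (A *v x) = (A *v x) \<bullet> r"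
        by (simp_all add: symmetric_matrix_inner[OF sym, of x r] inner_commute)
      moreover have "x \<bullet> (A *v x) = l" "r \<bullet> x = x \<bullet> r"
        by (simp_all add: l_def inner_commute)
      ultimately show ?thesis
        by (simp add: matrix_vector_right_distrib matrix_vector_mult_scaleR inner_add_left
            inner_add_right xx) (simp add: power2_eq_square algebra_simps)
    qed
    also have "l * (x \<bullet> r) - (A *v x) \<bullet> r = r \<bullet> r"
      by (simp add: r_def inner_diff_left)
    finally show ?thesis .
  qed
  then have "r \<bullet> r = 0"
    by (rule quadratic_nonneg_imp_linear_zero)
  then have "A *v x = l *\<^sub>R x"
    by (simp add: r_def)
  with x show ?thesis
    by (intro that) auto
qed

text \<open>A largest orthonormal set of eigenvectors is complete: by symmetry its orthogonal
  complement is invariant, and a nonzero complement would contribute one more unit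
  eigenvector.\<close>

lemma symmetric_matrix_orthonormal_eigenbasis:
  fixes A :: "real^'m^'m"
  assumes sym: "transpose A = A"
  obtains S where "pairwise orthogonal S" "card S = CARD('m)"
    "\<And>x. x \<in> S \<Longrightarrow> norm x = 1 \<and> (\<exists>l. A *v x = l *\<^sub>R x)"
proof -
  define P where "P S \<longleftrightarrow> finite S \<and> pairwise orthogonal S \<and> (\<forall>x\<in>S. norm x = 1 \<and> (\<exists>l. A *v x = l *\<^sub>R x))"
    for S
  have indep: "independent S" if "P S" for S
    using that by (intro pairwise_orthogonal_independent) (auto simp: P_def)
  have bound: "card S \<le> CARD('m)" if "P S" for S
    using independent_bound[OF indep[OF that]] by simp
  have "P {}" by (simp add: P_def)
  then have "\<exists>S. P S \<and> (\<forall>T. P T \<longrightarrow> card T \<le> card S)"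
    using bound by (intro ex_has_greatest_nat[of P _ card "Suc CARD('m)"]) (auto simp: less_Suc_eq_le)
  then obtain S where S: "P S" and max: "\<And>T. P T \<Longrightarrow> card T \<le> card S"
    by blast
  have "card S = CARD('m)"
  proof (rule ccontr)
    assume "card S \<noteq> CARD('m)"
    with bound[OF S] have lt: "card S < CARD('m)" by simp
    define W where "W = {x. \<forall>y\<in>S. y \<bullet> x = 0}"
    have sW: "subspace W"
      by (auto simp: W_def subspace_def inner_add_right)
    have "dim S < DIM(real^'m)"
      using lt by (simp add: dim_eq_card_independent[OF indep[OF S]])
    then obtain a where a: "a \<noteq> 0" "\<And>y. y \<in> span S \<Longrightarrow> orthogonal a y"
      using orthogonal_to_subspace_exists by blast
    then have "a \<in> W"
      by (auto simp: W_def span_base orthogonal_def inner_commute)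
    with a have nW: "W \<noteq> {0}" by auto
    have inv: "A *v x \<in> W" if "x \<in> W" for x
    proof -
      have "y \<bullet> (A *v x) = 0" if "y \<in> S" for y
      proof -
        obtain l where "A *v y = l *\<^sub>R y"
          using S \<open>y \<in> S\<close> unfolding P_def by meson
        then show ?thesis
          using \<open>x \<in> W\<close> that by (simp add: symmetric_matrix_inner[OF sym, of y] W_def)
      qed
      then show ?thesis by (simp add: W_def)
    qed
    obtain x l where x: "x \<in> W" "norm x = 1" "A *v x = l *\<^sub>R x"
      using symmetric_matrix_eigenvector_in_subspace[OF sym sW nW inv] by blast
    have "x \<notin> S"
      using x(1,2) by (auto simp: W_def norm_eq_1)
    moreover have "P (insert x S)"
      using S x by (auto simp: P_def pairwise_insert W_def orthogonal_def inner_commute)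
    ultimately show False
      using max[of "insert x S"] S by (simp add: P_def)
  qed
  with S show ?thesis
    by (intro that[of S]) (auto simp: P_def)
qed

lemma symmetric_matrix_diagonalization:
  fixes A :: "real^'m^'m"
  assumes sym: "transpose A = A"
  obtains Q d where "orthogonal_matrix Q" "A = Q ** diag_matrix d ** transpose Q"
proof -
  obtain S where S: "pairwise orthogonal S" "card S = CARD('m)"
    "\<And>x. x \<in> S \<Longrightarrow> norm x = 1 \<and> (\<exists>l. A *v x = l *\<^sub>R x)"
    using symmetric_matrix_orthonormal_eigenbasis[OF sym] by blast
  have "finite S"
    using S(2) by (metis card.infinite zero_less_card_finite less_irrefl)
  then obtain q :: "'m \<Rightarrow> real^'m" where q: "bij_betw q UNIV S"
    using S(2) finite_same_card_bij[of "UNIV :: 'm set" S] by auto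
  have qS: "q i \<in> S" for i
    using q by (auto simp: bij_betw_def)
  obtain d where d: "\<And>i. A *v q i = d i *\<^sub>R q i"
    using S(3)[OF qS] by metis
  define Q :: "real^'m^'m" where "Q = (\<chi> i j. q j $ i)"
  define D :: "real^'m" where "D = (\<chi> i. d i)"
  have col: "column i Q = q i" for i
    by (simp add: Q_def column_def)
  have "orthogonal (q i) (q j)" if "i \<noteq> j" for i j
    using S(1) qS that q unfolding pairwise_def bij_betw_def inj_on_def by blast
  then have Q: "orthogonal_matrix Q"
    by (simp add: orthogonal_matrix_orthonormal_columns col S(3) qS)
  have "A ** Q = Q ** diag_matrix D"
  proof -
    have "(A ** Q) $ i $ j = (A *v q j) $ i" for i j
      by (simp add: Q_def matrix_matrix_mult_def matrix_vector_mult_def)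
    then show ?thesis
      by (simp add: vec_eq_iff d diag_matrix_mult_right) (simp add: Q_def D_def)
  qed
  then have "A = Q ** diag_matrix D ** transpose Q"
    using Q unfolding orthogonal_matrix_def by (metis matrix_mul_assoc matrix_mul_rid)
  with Q show ?thesis by (rule that)
qed

subsection \<open>The quadratic form of the differentiation matrix\<close>

text \<open>A concave function lies above its chord; for a quadratic the gap is r (x - a) (b -
  x).\<close>

lemma concave_quadratic_nonneg:
  fixes f :: "real \<Rightarrow> real"
  assumes f: "\<And>x. f x = p + q * x - r * x\<^sup>2" and "r \<ge> 0"
    and "f a \<ge> 0" "f b \<ge> 0" "a \<le> x" "x \<le> b"
  shows "f x \<ge> 0"
proof (cases "a = b")
  case False
  have "f x * (b - a) = (b - x) * f a + (x - a) * f b + r * (x - a) * (b - x) * (b - a)"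
    unfolding f by (simp add: power2_eq_square algebra_simps)
  also have "\<dots> \<ge> 0"
    using assms by (intro add_nonneg_nonneg mult_nonneg_nonneg) auto
  finally show ?thesis
    using False assms(5,6) by (simp add: zero_le_mult_iff)
qed (use assms in auto)

text \<open>The case $v = w^4$ of the discriminant bound below, cleared of denominators. It is concave in $c$, and at
$c = 3/11$ and $c = 1$ it is a polynomial inequality in $w$.\<close>

lemma endpoint_quartic_bound:
  fixes c w :: real
  assumes c: "3/11 \<le> c" "c \<le> 1" and w: "0 \<le> w" "w \<le> 1"
  defines "m \<equiv> (1 + w)\<^sup>2 * (1 + w\<^sup>2)" and "n \<equiv> 1 - w^4"
  shows "(4 * c - (1 + 2 * c) * n + (1 - 2 * c) * m)\<^sup>2 \<le> 4 * m * (4 * c - n)"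
proof -
  define f where "f c = 4 * m * (4 * c - n) - (4 * c - (1 + 2 * c) * n + (1 - 2 * c) * m)\<^sup>2" for c
  define a where "a = 4 - 2 * n - 2 * m"
  have f: "f c = (- 4 * m * n - (m - n)\<^sup>2) + (16 * m - 2 * a * (m - n)) * c - a\<^sup>2 * c\<^sup>2" for c
    unfolding f_def a_def by algebra
  have "f (3/11) = (44 + 88 * w - 12 * w^2 - 112 * w^3 + 228 * w^4 + 328 * w^5 + 428 * w^6
      + 528 * w^7) / 121"
    unfolding f_def m_def n_def by (simp add: field_simps power2_eq_square) algebra
  also have "\<dots> \<ge> 0"
  proof -
    \<comment> \<open>Only the \<open>w^2\<close> and \<open>w^3\<close> terms are negative. They
      are absorbed by 44 + 88 w, since 44 + 88 w - 12 - 112 w = 32 - 24 w > 0 on [0,1].\<close>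
    have "w^2 \<le> 1" "w^3 \<le> w"
      using w by (auto simp: power_le_one_iff power3_eq_cube mult_le_one power2_eq_square mult_left_le_one_le)
    then have "0 \<le> 44 + 88 * w - 12 * w^2 - 112 * w^3" using w by simp
    then show ?thesis using w by simp
  qed
  finally have f0: "f (3/11) \<ge> 0" .
  have "f 1 = 4 * (3 + 6 * w + 5 * w^2 + 4 * w^3 + w^4 + 2 * w^5 + 3 * w^6 + 4 * w^7)"
    unfolding f_def m_def n_def by algebra
  then have f1: "f 1 \<ge> 0"
    using w by simp
  have "f c \<ge> 0"
    by (rule concave_quadratic_nonneg[OF f _ f0 f1 c]) simp
  then show ?thesis by (simp add: f_def)
qed

text \<open>With \<^term>\<open>v = exp z\<close> and \<^term>\<open>w = exp (c * z)\<close> this is the discriminant condition for the symmetric part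
of $D^{(2,w)}(c, z)$ divided by $z^2$. The right side minus the left is a concave quadratic in $A$, so only the
endpoints $v = w$ and $v = w^4$ need checking; $w^4 \<le> v$ holds as soon as $c \<ge> 1/4$.\<close>

lemma d2w_discriminant_bound:
  fixes c v w :: real
  assumes c: "3/11 \<le> c" "c \<le> 1" and w: "0 < w" "w < 1" and v: "w^4 \<le> v" "v \<le> w"
  defines "A \<equiv> 1 / (1 - v)" and "B \<equiv> 1 / (1 - w)"
  shows "(2 * c * A + (1 - 2 * c) * B - 1)\<^sup>2 \<le> 4 * (B - 1/2) * (2 * c * A - 1/2)"
proof -
  define f where "f a = 4 * (B - 1/2) * (2 * c * a - 1/2) - (2 * c * a + (1 - 2 * c) * B - 1)\<^sup>2" for a
  have f: "f a = (1 - 2 * B - ((1 - 2 * c) * B - 1)\<^sup>2)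
      + (4 * c * (2 * B - 1) - 4 * c * ((1 - 2 * c) * B - 1)) * a - (2 * c)\<^sup>2 * a\<^sup>2" for a
    unfolding f_def by (simp add: field_simps power2_eq_square)
  \<comment> \<open>Since 1 - w^4 = (1 - w)(1 + w)(1 + w^2), the quotient m / n equals (1 + w) / (1
    - w) = 2 B - 1.\<close>
  define n where "n = 1 - w^4"
  define m where "m = (1 + w)\<^sup>2 * (1 + w\<^sup>2)"
  have n: "n > 0"
    using w by (simp add: n_def power_less_one_iff)
  have B: "2 * B * n = m + n"
    using w unfolding B_def m_def n_def by (simp add: field_simps) algebra
  \<comment> \<open>The value 1 / n of \<open>A\<close> belongs to v = w^4; the factor 4 n^2 clears
    the denominators.\<close>
  have "4 * n\<^sup>2 * f (1 / n) = 4 * m * (4 * c - n) - (4 * c - (1 + 2 * c) * n + (1 - 2 * c) * m)\<^sup>2"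
  proof -
    have m: "m = 2 * B * n - n" using B by simp
    have n1: "n * (1 / n) = 1" using n by simp
    show ?thesis
      unfolding f_def m using n1 by algebra
  qed
  also have "\<dots> \<ge> 0"
    using endpoint_quartic_bound[OF c, of w] w by (simp add: m_def n_def)
  finally have f0: "f (1 / n) \<ge> 0"
    using n by (simp add: zero_le_mult_iff)
  have "B \<ge> 1"
    using w by (simp add: B_def)
  \<comment> \<open>The other endpoint \<open>B\<close> belongs to v = w, where \<open>f\<close>
    factors. Its second factor is nonnegative because B >= 1 and 4 c >= 1.\<close>
  have "4 * c \<le> (8 * c - 1) * 1"
    using c by simp
  also have "\<dots> \<le> (8 * c - 1) * B"
    using c \<open>B \<ge> 1\<close> by (intro mult_left_mono) auto
  finally have "(8 * c - 1) * B - 4 * c \<ge> 0"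
    by simp
  moreover have "f B = B * ((8 * c - 1) * B - 4 * c)"
    unfolding f_def by (simp add: field_simps power2_eq_square)
  ultimately have f1: "f B \<ge> 0"
    using \<open>B \<ge> 1\<close> by simp
  have "f A \<ge> 0"
  proof (rule concave_quadratic_nonneg[OF f _ f0 f1])
    show "1 / n \<le> A" "A \<le> B"
      using v w n by (auto simp: A_def B_def n_def intro!: frac_le)
  qed simp
  then show ?thesis by (simp add: f_def)
qed

section \<open>Nonnegativity of the form for each negative eigenvalue\<close>

lemma phi1_pos: "phi1 z > 0"
  by (auto simp: phi1_def zero_less_divide_iff)

text \<open>In the variable 1 / (1 - exp z) the entries of D / (- z) become affine
  expressions.\<close>

lemma inverse_phi1: "z \<noteq> 0 \<Longrightarrow> 1 / phi1 z = - z * (1 / (1 - exp z))"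
  by (simp add: phi1_def divide_simps) (simp add: algebra_simps)

text \<open>The leading coefficient is positive and the discriminant bound, scaled by z^2, applies;
  completing the square finishes.\<close>

lemma d2w_quadratic_form_nonneg:
  assumes c: "3/11 \<le> c" "c \<le> 1" and z: "z < 0"
  shows "0 \<le> d2w c 1 1 z * x\<^sup>2 + d2w c 2 1 z * (x * y) + d2w c 2 2 z * y\<^sup>2"
proof -
  define v w where "v = exp z" and "w = exp (c * z)"
  define A B where "A = 1 / (1 - v)" and "B = 1 / (1 - w)"
  have w: "0 < w" "w < 1"
    using c z by (auto simp: w_def mult_pos_neg)
  \<comment> \<open>As z < 0, these are the exponent bounds 4 c >= 1 and c <= 1.\<close>
  have v: "w^4 \<le> v" "v \<le> w"
    using c z by (auto simp: v_def w_def simp flip: exp_of_nat_mult)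
  have phi: "1 / phi1 z = - z * A"
    using z by (simp add: inverse_phi1 A_def v_def)
  have phic: "1 / (c * phi1 (c * z)) = - z * B"
    using inverse_phi1[of "c * z"] c z by (auto simp: B_def w_def divide_simps)
  have d11: "d2w c 1 1 z = - z * (B - 1/2)"
    unfolding d2w_def by (simp add: phic algebra_simps)
  have d21: "d2w c 2 1 z = - z * (2 * c * A + (1 - 2 * c) * B - 1)"
    using arg_cong[OF phi, of "(*) (2 * c)"] arg_cong[OF phic, of "(*) (1 - 2 * c)"]
    unfolding d2w_def by (simp add: algebra_simps)
  have d22: "d2w c 2 2 z = - z * (2 * c * A - 1/2)"
    using arg_cong[OF phi, of "(*) (2 * c)"] unfolding d2w_def by (simp add: algebra_simps)
  have "B > 1"
    using w by (simp add: B_def)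
  then have pos: "0 < d2w c 1 1 z"
    unfolding d11 using z by (intro mult_pos_pos) auto
  have "z\<^sup>2 * (2 * c * A + (1 - 2 * c) * B - 1)\<^sup>2 \<le> z\<^sup>2 * (4 * (B - 1/2) * (2 * c * A - 1/2))"
    unfolding A_def B_def by (intro mult_left_mono d2w_discriminant_bound c w v) simp
  then have disc: "(d2w c 2 1 z)\<^sup>2 \<le> 4 * d2w c 1 1 z * d2w c 2 2 z"
    unfolding d11 d21 d22 by (simp add: power2_eq_square mult_ac)
  have "4 * d2w c 1 1 z * (d2w c 1 1 z * x\<^sup>2 + d2w c 2 1 z * (x * y) + d2w c 2 2 z * y\<^sup>2)
      = (2 * d2w c 1 1 z * x + d2w c 2 1 z * y)\<^sup>2
        + (4 * d2w c 1 1 z * d2w c 2 2 z - (d2w c 2 1 z)\<^sup>2) * y\<^sup>2"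
    by algebra
  also have "\<dots> \<ge> 0"
    using disc by simp
  finally show ?thesis
    using pos by (simp add: zero_le_mult_iff)
qed

subsection \<open>Energy dissipation\<close>

text \<open>The descent lemma: along the segment the directional derivative exceeds its initial
  value by at most C t |w - v|^2.\<close>

lemma lipschitz_gradient_upper_bound:
  fixes F :: "'a::euclidean_space \<Rightarrow> real" and g :: "'a \<Rightarrow> 'a"
  assumes grad: "\<And>v. GDERIV F v :> g v" and lip: "C-lipschitz_on UNIV g"
  shows "F w \<le> F v + g v \<bullet> (w - v) + C / 2 * ((w - v) \<bullet> (w - v))"
proof -
  define e where "e = w - v"
  \<comment> \<open>With the linear and quadratic parts subtracted, the claim reads h 1 <= h 0, so
    it suffices that \<open>h\<close> is nonincreasing on [0,1].\<close>
  define h where "h t = F (v + t *\<^sub>R e) - t * (g v \<bullet> e) - C / 2 * t\<^sup>2 * (e \<bullet> e)" for t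
  have "(h has_real_derivative (g (v + t *\<^sub>R e) \<bullet> e - g v \<bullet> e - C * t * (e \<bullet> e))) (at t)" for t
  proof -
    have "((\<lambda>t. F (v + t *\<^sub>R e)) has_derivative (\<lambda>s. (s *\<^sub>R e) \<bullet> g (v + t *\<^sub>R e))) (at t)"
      by (rule has_derivative_compose[of "\<lambda>t. v + t *\<^sub>R e", OF _ grad[unfolded gderiv_def]])
        (auto intro!: derivative_eq_intros)
    then have "((\<lambda>t. F (v + t *\<^sub>R e)) has_real_derivative (g (v + t *\<^sub>R e) \<bullet> e)) (at t)"
      by (rule has_derivative_imp_has_field_derivative) (simp add: inner_commute)
    then show ?thesis
      unfolding h_def by (auto intro!: derivative_eq_intros)
  qed
  moreover have "g (v + t *\<^sub>R e) \<bullet> e - g v \<bullet> e - C * t * (e \<bullet> e) \<le> 0" if "t \<ge> 0" for t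
  proof -
    have "(g (v + t *\<^sub>R e) - g v) \<bullet> e \<le> norm (g (v + t *\<^sub>R e) - g v) * norm e"
      by (rule norm_cauchy_schwarz)
    also have "\<dots> \<le> (C * norm (t *\<^sub>R e)) * norm e"
      using lipschitz_onD[OF lip, of "v + t *\<^sub>R e" v]
      by (intro mult_right_mono) (auto simp: dist_norm)
    also have "\<dots> = C * t * (e \<bullet> e)"
      using that by (simp add: dot_square_norm power2_eq_square)
    finally show ?thesis by (simp add: inner_diff_left)
  qed
  ultimately have "h 1 \<le> h 0"
    by (intro DERIV_nonpos_imp_nonincreasing[of 0 1 h]) (auto intro!: exI)
  then show ?thesis
    by (simp add: h_def e_def)
qed

section \<open>Coordinates that diagonalize all functions of a symmetric matrix\<close>

text \<open>One pair \<open>P\<close>, \<open>z\<close> serves every \<open>f\<close>, so identities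
  between several matrix functions can be checked as scalar identities at each eigenvalue.\<close>

lemma symmetric_matrix_fun_eigencoordinates:
  fixes A :: "real^'m^'m"
  assumes "transpose A = A"
  obtains P z where "orthogonal_matrix P" "\<And>x i. (P *v (A *v x)) $ i = z $ i * (P *v x) $ i"
    "\<And>f x i. (P *v (matrix_fun f A *v x)) $ i = f (z $ i) * (P *v x) $ i"
proof -
  obtain Q z where Q: "orthogonal_matrix Q" and A: "A = Q ** diag_matrix z ** transpose Q"
    using symmetric_matrix_diagonalization[OF assms] .
  have *: "(transpose Q *v ((Q ** diag_matrix d ** transpose Q) *v x)) $ i = d $ i * (transpose Q *v x) $ i"
    for d x i
  proof -
    have "transpose Q ** (Q ** diag_matrix d ** transpose Q) = diag_matrix d ** transpose Q"
      using Q by (simp add: matrix_mul_assoc orthogonal_matrix_def)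
    then have "transpose Q *v ((Q ** diag_matrix d ** transpose Q) *v x) = diag_matrix d *v (transpose Q *v x)"
      by (simp only: matrix_vector_mul_assoc)
    then show ?thesis
      by (simp add: diag_matrix_def matrix_vector_mult_def if_distrib[of "\<lambda>x. x * _"] cong: if_cong)
  qed
  show ?thesis
  proof (rule that[of "transpose Q" z])
    show "(transpose Q *v (matrix_fun f A *v x)) $ i = f (z $ i) * (transpose Q *v x) $ i" for f x i
      unfolding A matrix_fun_diagonalization[OF Q] * by simp
    show "(transpose Q *v (A *v x)) $ i = z $ i * (transpose Q *v x) $ i" for x i
      unfolding A by (rule *)
  qed (use Q in simp)
qed

lemma orthogonal_matrix_inner:
  fixes P :: "real^'m^'m"
  assumes "orthogonal_matrix P"
  shows "(P *v x) \<bullet> (P *v y) = x \<bullet> y"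
  using assms orthogonal_transformation_matrix[of "(*v) P"]
  by (simp add: orthogonal_transformation_def matrix_vector_mul_linear)

lemma orthogonal_matrix_vector_eqI:
  fixes P :: "real^'m^'m"
  assumes "orthogonal_matrix P" and "\<And>i. (P *v x) $ i = (P *v y) $ i"
  shows "x = y"
proof -
  have "P *v x = P *v y"
    using assms(2) by (simp add: vec_eq_iff)
  then have "transpose P *v (P *v x) = transpose P *v (P *v y)"
    by simp
  then show ?thesis
    using assms(1) by (simp add: matrix_vector_mul_assoc orthogonal_matrix_def)
qed

section \<open>Energy increment of one stage\<close>

lemma L_stab_mult: "L_stab \<kappa> L *v v = L *v v + \<kappa> *\<^sub>R v"
  by (simp add: L_stab_def matrix_vector_mult_add_rdistrib scaleR_matrix_vector_assoc[symmetric])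

text \<open>The quadratic energy is expanded exactly, and the descent lemma costs at most (kappa/2)
  |w - v|^2, which the stabilized quadratic form absorbs. In the linear term the two kappa
  contributions cancel.\<close>

lemma energy_stage_bound:
  fixes L :: "real^'m^'m" and G g :: "real^'m \<Rightarrow> real^'m"
  assumes L: "transpose L = L" and grad: "\<And>v. GDERIV (\<lambda>w. G w \<bullet> 1) v :> - g v"
    and lip: "C-lipschitz_on UNIV g" and "C \<le> \<kappa>"
  shows "energy L G w - energy L G v
    \<le> - ((w - v) \<bullet> (g_stab \<kappa> g v - L_stab \<kappa> L *v v)) + 1/2 * ((w - v) \<bullet> (L_stab \<kappa> L *v (w - v)))"
proof -
  define d where "d = w - v"
  have w: "w = v + d" by (simp add: d_def)
  have "C-lipschitz_on UNIV (\<lambda>v. - g v)"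
    using lip by (simp add: lipschitz_on_def dist_minus)
  from lipschitz_gradient_upper_bound[OF grad this, of w v]
  have "G w \<bullet> 1 \<le> G v \<bullet> 1 - g v \<bullet> d + C / 2 * (d \<bullet> d)"
    by (simp add: d_def)
  also have "C / 2 * (d \<bullet> d) \<le> \<kappa> / 2 * (d \<bullet> d)"
    using \<open>C \<le> \<kappa>\<close> by (intro mult_right_mono) auto
  finally have G: "G w \<bullet> 1 \<le> G v \<bullet> 1 - g v \<bullet> d + \<kappa> / 2 * (d \<bullet> d)" by simp
  have "v \<bullet> (L *v d) = d \<bullet> (L *v v)"
    by (simp add: symmetric_matrix_inner[OF L, of v d] inner_commute)
  then have "1/2 * (w \<bullet> (L *v w)) = 1/2 * (v \<bullet> (L *v v)) + d \<bullet> (L *v v) + 1/2 * (d \<bullet> (L *v d))"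
    by (simp add: w matrix_vector_right_distrib inner_add_left inner_add_right)
  with G show ?thesis
    unfolding energy_def d_def[symmetric]
    by (simp add: L_stab_mult g_stab_def inner_add_right inner_diff_right inner_commute[of "g v"]
        add_divide_distrib)
qed

lemma orthogonal_matrix_inner_sum:
  fixes P :: "real^'m^'m"
  assumes "orthogonal_matrix P"
  shows "x \<bullet> y = (\<Sum>i\<in>UNIV. (P *v x) $ i * (P *v y) $ i)"
  unfolding orthogonal_matrix_inner[OF assms, of x y, symmetric] by (simp add: inner_vec_def)

section \<open>Stagewise dissipation for the method\<close>

theorem corollary3p2:
  fixes L :: "real^'m^'m" and G g :: "real^'m \<Rightarrow> real^'m"
    and u :: "nat \<Rightarrow> real^'m" and U :: "nat \<Rightarrow> nat \<Rightarrow> real^'m"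
    and c2 \<kappa> \<tau> lg :: real and n j :: nat
  assumes "sym_pos_def L"
    and "\<And>v i. 0 \<le> G v $ i"
    and "\<And>v. GDERIV (\<lambda>w. G w \<bullet> 1) v :> - g v"
    and "lg > 0" and "lg-lipschitz_on UNIV g"
    and "\<kappa> \<ge> 2 * lg"
    and "c2 \<in> {3/11..1}"
    and "\<tau> > 0"
    and "eerk2w_method c2 \<tau> \<kappa> L g u U"
    and "n \<ge> 1" and "j \<in> {1, 2}"
  shows "energy L G (U n (j + 1)) - energy L G (U n 1)
           \<le> - (1 / \<tau>) * (\<Sum>k=1..j. delta_stage (U n) (k + 1) \<bullet>
               (\<Sum>l=1..k. matrix_fun (d2w c2 k l) (- \<tau> *\<^sub>R L_stab \<kappa> L) *v delta_stage (U n) (l + 1)))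
       \<and> - (1 / \<tau>) * (\<Sum>k=1..j. delta_stage (U n) (k + 1) \<bullet>
               (\<Sum>l=1..k. matrix_fun (d2w c2 k l) (- \<tau> *\<^sub>R L_stab \<kappa> L) *v delta_stage (U n) (l + 1))) \<le> 0"
proof -
  note L = assms(1) and grad = assms(3) and lg = assms(4) and lip = assms(5) and \<kappa> = assms(6)
    and c2 = assms(7) and \<tau> = assms(8)
  define K where "K = L_stab \<kappa> L"
  define A where "A = - \<tau> *\<^sub>R K"
  have symL: "transpose L = L"
    using L by (simp add: sym_pos_def_def)
  have symA: "transpose A = A"
    using symL by (simp add: A_def K_def L_stab_def transpose_def mat_def vec_eq_iff)
  have A_mult: "A *v v = - (\<tau> *\<^sub>R (K *v v))" for v
    unfolding A_def scaleR_matrix_vector_assoc[symmetric] by simp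
  have A_neg: "v \<bullet> (A *v v) < 0" if "v \<noteq> 0" for v
  proof -
    have "0 < v \<bullet> (L *v v) + \<kappa> * (v \<bullet> v)"
      using L that lg \<kappa> by (intro add_pos_nonneg) (auto simp: sym_pos_def_def)
    then show ?thesis
      using \<tau> by (simp add: A_mult K_def L_stab_mult inner_add_right)
  qed
  obtain P z where P: "orthogonal_matrix P" and PA: "\<And>x i. (P *v (A *v x)) $ i = z $ i * (P *v x) $ i"
    and Pf: "\<And>f x i. (P *v (matrix_fun f A *v x)) $ i = f (z $ i) * (P *v x) $ i"
    using symmetric_matrix_fun_eigencoordinates[OF symA] by blast
  \<comment> \<open>Each \<open>z $ i\<close> is the value of the quadratic form of \<open>A\<close>
    at the eigenvector mapped by \<open>P\<close> to a coordinate vector, and \<open>A\<close> is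
    negative definite.\<close>
  have z: "z $ i < 0" for i
  proof -
    define v where "v = transpose P *v axis i 1"
    have Pv: "P *v v = axis i 1"
      using P by (simp add: v_def matrix_vector_mul_assoc orthogonal_matrix_def del: transpose_matrix_vector)
    then have "v \<noteq> 0" by (auto simp: axis_eq_0_iff)
    moreover have "v \<bullet> (A *v v) = z $ i"
      by (subst orthogonal_matrix_inner[OF P, symmetric]) (simp add: Pv inner_axis' PA)
    ultimately show ?thesis
      using A_neg[of v] by simp
  qed
  define V where "V = U n"
  define D where "D k l = matrix_fun (d2w c2 k l) A" for k l
  define r where "r k = g_stab \<kappa> g (V k) - K *v V k" for k
  \<comment> \<open>The scheme keeps the linear term at the first stage, so \<open>s\<close> differs
    from the residual \<open>r 2\<close> that the energy estimate requires.\<close>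
  define s where "s = g_stab \<kappa> g (V 2) - K *v V 1"
  define \<delta> where "\<delta> = delta_stage V"
  have \<delta>2: "\<delta> 2 = V 2 - V 1" and \<delta>3: "\<delta> 3 = V 3 - V 2"
    by (simp_all add: \<delta>_def delta_stage_def)
  have stage: "V (i + 1) = V 1 + (\<Sum>j=1..i. matrix_fun (eerk2w_coeff c2 (i + 1) j) A *v
      (\<tau> *\<^sub>R (g_stab \<kappa> g (V j) - K *v V 1)))" if "i \<in> {1,2}" for i
    using assms(9,10) that unfolding eerk2w_method_def V_def A_def K_def scaleR_diff_right by blast
  have "V 2 = V 1 + matrix_fun (eerk2w_coeff c2 2 1) A *v (\<tau> *\<^sub>R r 1)"
    using stage[of 1] unfolding r_def by (simp add: numeral_2_eq_2)
  then have V2: "\<delta> 2 = matrix_fun (eerk2w_coeff c2 2 1) A *v (\<tau> *\<^sub>R r 1)"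
    unfolding \<delta>2 by simp
  have "V 3 = V 1 + (matrix_fun (eerk2w_coeff c2 3 1) A *v (\<tau> *\<^sub>R r 1)
      + matrix_fun (eerk2w_coeff c2 3 2) A *v (\<tau> *\<^sub>R s))"
    using stage[of 2] unfolding r_def s_def by (simp add: numeral_2_eq_2 numeral_3_eq_3)
  then have V3: "\<delta> 2 + \<delta> 3 = matrix_fun (eerk2w_coeff c2 3 1) A *v (\<tau> *\<^sub>R r 1)
      + matrix_fun (eerk2w_coeff c2 3 2) A *v (\<tau> *\<^sub>R s)"
    unfolding \<delta>2 \<delta>3 by simp
  \<comment> \<open>Moving the linear term from \<open>V 1\<close> to \<open>V 2\<close> adds
    \<open>A *v \<delta> 2\<close>, the source of the summand z in the lower left entry of
    D.\<close>
  have r2: "\<tau> *\<^sub>R r 2 = \<tau> *\<^sub>R s + A *v \<delta> 2"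
    by (simp add: r_def s_def \<delta>2 A_mult matrix_vector_mult_diff_distrib algebra_simps)
  \<comment> \<open>In each eigencoordinate the first stage is inverted by dividing by a = c2
    phi1(c2 z) > 0; the half step of \<open>A\<close> supplies z/2.\<close>
  have res1: "\<tau> *\<^sub>R r 1 + (1/2) *\<^sub>R (A *v \<delta> 2) = D 1 1 *v \<delta> 2"
  proof (rule orthogonal_matrix_vector_eqI[OF P])
    fix i
    define a where "a = c2 * phi1 (c2 * z $ i)"
    define x p where "x = (P *v (\<tau> *\<^sub>R r 1)) $ i" and "p = (P *v \<delta> 2) $ i"
    have "a > 0"
      using c2 phi1_pos by (simp add: a_def)
    moreover have "p = a * x"
      unfolding p_def V2 Pf by (simp only: eerk2w_coeff_def a_def x_def refl simp_thms if_True)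
    moreover have "d2w c2 1 1 (z $ i) = 1 / a + z $ i / 2"
      by (simp add: d2w_def a_def)
    ultimately have "x + 1/2 * (z $ i * p) = d2w c2 1 1 (z $ i) * p"
      by (simp add: distrib_right)
    then show "(P *v (\<tau> *\<^sub>R r 1 + (1/2) *\<^sub>R (A *v \<delta> 2))) $ i = (P *v (D 1 1 *v \<delta> 2)) $ i"
      unfolding D_def
      by (simp only: matrix_vector_right_distrib matrix_vector_mult_scaleR[of P "1/2"] PA Pf
          vector_add_component vector_scaleR_component real_scaleR_def x_def p_def)
  qed
  \<comment> \<open>The last stage is solved for the coordinate \<open>y\<close> of the scaled
    \<open>s\<close>, after eliminating \<open>x\<close> by p = a x. Dividing by phi1(z) > 0
    produces row 2 of D.\<close>
  have res2: "\<tau> *\<^sub>R r 2 + (1/2) *\<^sub>R (A *v \<delta> 3) = D 2 1 *v \<delta> 2 + D 2 2 *v \<delta> 3"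
  proof (rule orthogonal_matrix_vector_eqI[OF P])
    fix i
    define a f where "a = c2 * phi1 (c2 * z $ i)" and "f = phi1 (z $ i)"
    define x y where "x = (P *v (\<tau> *\<^sub>R r 1)) $ i" and "y = (P *v (\<tau> *\<^sub>R s)) $ i"
    define p q where "p = (P *v \<delta> 2) $ i" and "q = (P *v \<delta> 3) $ i"
    have pos: "a > 0" "f > 0" "c2 > 0"
      using c2 phi1_pos by (simp_all add: a_def f_def)
    have "p = a * x"
      unfolding p_def V2 Pf by (simp only: eerk2w_coeff_def a_def x_def refl simp_thms if_True)
    then have x: "x = p / a"
      using pos by simp
    have "(P *v (\<delta> 2 + \<delta> 3)) $ i = eerk2w_coeff c2 3 1 (z $ i) * x + eerk2w_coeff c2 3 2 (z $ i) * y"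
      unfolding V3 matrix_vector_right_distrib vector_add_component Pf x_def y_def ..
    then have "p + q = (1 - 1 / (2 * c2)) * f * x + 1 / (2 * c2) * f * y"
      by (simp add: matrix_vector_right_distrib eerk2w_coeff_def f_def p_def q_def)
    then have "f * y = 2 * c2 * (p + q) + (1 - 2 * c2) * f * x"
      using pos by (simp add: field_simps)
    then have "y = (2 * c2 * (p + q) + (1 - 2 * c2) * f * x) / f"
      using pos by (simp add: eq_divide_eq mult.commute)
    also have "\<dots> = 2 * c2 / f * (p + q) + (1 - 2 * c2) / a * p"
      using pos by (simp add: x add_divide_distrib)
    finally have y: "y = 2 * c2 / f * (p + q) + (1 - 2 * c2) / a * p" .
    have "d2w c2 2 1 (z $ i) = 2 * c2 / f + (1 - 2 * c2) / a + z $ i"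
      "d2w c2 2 2 (z $ i) = 2 * c2 / f + z $ i / 2"
      by (simp_all add: d2w_def a_def f_def)
    then have "y + z $ i * p + 1/2 * (z $ i * q)
        = d2w c2 2 1 (z $ i) * p + d2w c2 2 2 (z $ i) * q"
      by (simp add: y distrib_right distrib_left)
    then show "(P *v (\<tau> *\<^sub>R r 2 + (1/2) *\<^sub>R (A *v \<delta> 3))) $ i
        = (P *v (D 2 1 *v \<delta> 2 + D 2 2 *v \<delta> 3)) $ i"
      unfolding r2 D_def
      by (simp only: matrix_vector_right_distrib matrix_vector_mult_scaleR[of P "1/2"] PA Pf
          vector_add_component vector_scaleR_component real_scaleR_def y_def p_def q_def)
  qed
  have step: "energy L G (V (Suc k)) - energy L G (V k)
      \<le> - (1 / \<tau>) * (\<delta> (Suc k) \<bullet> (\<tau> *\<^sub>R r k + (1/2) *\<^sub>R (A *v \<delta> (Suc k))))" for k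
  proof -
    have "lg \<le> \<kappa>" using lg \<kappa> by simp
    have "- (1 / \<tau>) * (d \<bullet> (\<tau> *\<^sub>R r k + (1/2) *\<^sub>R (A *v d))) = - (d \<bullet> r k) + 1/2 * (d \<bullet> (K *v d))"
      for d
      using \<tau> by (simp add: A_mult inner_add_right inner_diff_right diff_divide_distrib)
    then show ?thesis
      using energy_stage_bound[OF symL grad lip \<open>lg \<le> \<kappa>\<close>, of "V (Suc k)" "V k"]
      by (simp only: \<delta>_def delta_stage_def r_def K_def diff_Suc_1)
  qed
  define T1 where "T1 = \<delta> 2 \<bullet> (D 1 1 *v \<delta> 2)"
  define T2 where "T2 = \<delta> 3 \<bullet> (D 2 1 *v \<delta> 2 + D 2 2 *v \<delta> 3)"
  have E1: "energy L G (V 2) - energy L G (V 1) \<le> - (1 / \<tau>) * T1"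
    using step[of 1] unfolding T1_def res1[symmetric] by (simp add: numeral_2_eq_2)
  have E2: "energy L G (V 3) - energy L G (V 2) \<le> - (1 / \<tau>) * T2"
    using step[of 2] unfolding T2_def res2[symmetric] by (simp add: numeral_3_eq_3 numeral_2_eq_2)
  have c: "3/11 \<le> c2" "c2 \<le> 1"
    using c2 by auto
  define p q where "p i = (P *v \<delta> 2) $ i" and "q i = (P *v \<delta> 3) $ i" for i
  have T1: "T1 = (\<Sum>i\<in>UNIV. p i * (d2w c2 1 1 (z $ i) * p i))"
    unfolding T1_def D_def orthogonal_matrix_inner_sum[OF P] Pf p_def ..
  have T2: "T2 = (\<Sum>i\<in>UNIV. q i * (d2w c2 2 1 (z $ i) * p i + d2w c2 2 2 (z $ i) * q i))"
    unfolding T2_def D_def orthogonal_matrix_inner_sum[OF P] matrix_vector_right_distrib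
      vector_add_component Pf p_def q_def ..
  \<comment> \<open>Setting the second variable to 0 gives T1 >= 0. The full form couples both rows,
    so it bounds \<open>T1 + T2\<close> rather than \<open>T2\<close> by itself.\<close>
  note form = d2w_quadratic_form_nonneg[OF c z]
  have "p i * (d2w c2 1 1 (z $ i) * p i) \<ge> 0" for i
    using form[of i "p i" 0] by (simp add: power2_eq_square mult_ac)
  then have T1_nonneg: "T1 \<ge> 0"
    unfolding T1 by (intro sum_nonneg)
  have "p i * (d2w c2 1 1 (z $ i) * p i)
      + q i * (d2w c2 2 1 (z $ i) * p i + d2w c2 2 2 (z $ i) * q i) \<ge> 0" for i
    using form[of i "p i" "q i"] by (simp add: power2_eq_square distrib_left mult_ac)
  then have T12_nonneg: "T1 + T2 \<ge> 0"
    unfolding T1 T2 sum.distrib[symmetric] by (intro sum_nonneg)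
  have "energy L G (V (j + 1)) - energy L G (V 1)
      \<le> - (1 / \<tau>) * (\<Sum>k=1..j. \<delta> (k + 1) \<bullet> (\<Sum>l=1..k. D k l *v \<delta> (l + 1)))
    \<and> - (1 / \<tau>) * (\<Sum>k=1..j. \<delta> (k + 1) \<bullet> (\<Sum>l=1..k. D k l *v \<delta> (l + 1))) \<le> 0"
  proof (cases "j = 1")
    case True
    have "(\<Sum>k=1..j. \<delta> (k + 1) \<bullet> (\<Sum>l=1..k. D k l *v \<delta> (l + 1))) = T1"
      by (simp add: True T1_def numeral_2_eq_2)
    then show ?thesis
      using True E1 T1_nonneg \<tau> by (simp add: numeral_2_eq_2)
  next
    case False
    then have j: "j = 2"
      using assms(11) by simp
    have "(\<Sum>k=1..j. \<delta> (k + 1) \<bullet> (\<Sum>l=1..k. D k l *v \<delta> (l + 1))) = T1 + T2"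
      by (simp add: j T1_def T2_def numeral_2_eq_2 numeral_3_eq_3)
    \<comment> \<open>The two stage increments telescope.\<close>
    moreover have "energy L G (V 3) - energy L G (V 1) \<le> - (1 / \<tau>) * (T1 + T2)"
      using E1 E2 by (simp add: distrib_left)
    ultimately show ?thesis
      using j T12_nonneg \<tau> by simp
  qed
  then show ?thesis
    unfolding V_def \<delta>_def D_def A_def K_def .
qed

end
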